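(* Let $G$ be an SCT graph with $V$ vertices. If $G$ has a $k$-let with $k \ge 3$, then $\operatorname{codim}(I_G) \le V-k+1$.
   Context: An SCT graph is a finite simple connected graph (no loops or multiple edges) in which every vertex has degree at least $2$. Label the vertices $v_0,\ldots,v_{V-1}$ and let $G_i$ (also written $G_{v_i}$) be the set of vertices adjacent to $v_i$. In the polynomial ring $R=\mathbb{C}[x_0,\ldots,x_{V-1},y_0,\ldots,y_{V-1}]$ put $$f_i=\sum_{v_j\in G_i}(x_jy_i-x_iy_j),\qquad 0\le i\le V-1,$$ and let $I_G=\langle f_0,\ldots,f_{V-1}\rangle$. A $k$-let is a set $S$ of $k$ distinct vertices of $G$ such that $G_v=G_w$ for all $v,w\in S$. For an ideal $I\subset \mathbb{C}[z_1,\ldots,z_m]$, $\operatorname{codim}(I)=m-\dim \mathbb{V}(I)$, where $\mathbb{V}(I)\subset\mathbb{C}^m$ is the set of common zeros of $I$. *)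

theory Defs
  imports "HOL-Analysis.Analysis" "HOL-Library.Poly_Mapping"
begin

section \<open>Graphs\<close>

text \<open>A finite simple graph on the vertex type \<open>'a::finite\<close> is given by its adjacency relation;
  the number of vertices is \<open>CARD('a)\<close>.\<close>

definition nbrs :: "('a \<Rightarrow> 'a \<Rightarrow> bool) \<Rightarrow> 'a \<Rightarrow> 'a set" where
  "nbrs E v = {w. E v w}"

definition sct_graph :: "('a::finite \<Rightarrow> 'a \<Rightarrow> bool) \<Rightarrow> bool" where
  "sct_graph E \<longleftrightarrow> symp E \<and> irreflp E \<and> (\<forall>u v. E\<^sup>*\<^sup>* u v) \<and> (\<forall>v. card (nbrs E v) \<ge> 2)"

definition is_let :: "('a::finite \<Rightarrow> 'a \<Rightarrow> bool) \<Rightarrow> nat \<Rightarrow> 'a set \<Rightarrow> bool" where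
  "is_let E k S \<longleftrightarrow> card S = k \<and> (\<forall>v\<in>S. \<forall>w\<in>S. nbrs E v = nbrs E w)"

section \<open>Complex polynomials in the variables indexed by a finite type\<close>

text \<open>A polynomial maps exponent vectors to coefficients; multiplication of \<open>poly_mapping\<close>s is
  convolution, so this type carries the ring structure of the polynomial ring.\<close>

type_synonym 'v cpoly = "('v \<Rightarrow>\<^sub>0 nat) \<Rightarrow>\<^sub>0 complex"

definition var :: "'v \<Rightarrow> 'v cpoly" where
  "var i = Poly_Mapping.single (Poly_Mapping.single i 1) 1"

definition eval_cpoly :: "'v::finite cpoly \<Rightarrow> complex ^ 'v \<Rightarrow> complex" where
  "eval_cpoly p z = (\<Sum>m\<in>Poly_Mapping.keys p.
     Poly_Mapping.lookup p m * (\<Prod>i\<in>UNIV. (z $ i) ^ Poly_Mapping.lookup m i))"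

text \<open>The ideal generated by a subset of a commutative ring is its span in the ring regarded as a
  module over itself.\<close>

definition ideal_gen :: "'r::comm_ring_1 set \<Rightarrow> 'r set" where
  "ideal_gen B = module.span (*) B"

lemma module_times: "module ((*) :: 'r::comm_ring_1 \<Rightarrow> 'r \<Rightarrow> 'r)"
  by unfold_locales (simp_all add: algebra_simps)

section \<open>Affine algebraic sets, dimension and codimension\<close>

definition zero_locus :: "'v::finite cpoly set \<Rightarrow> (complex ^ 'v) set" where
  "zero_locus I = {z. \<forall>p\<in>I. eval_cpoly p z = 0}"

definition algebraic_set :: "(complex ^ 'v::finite) set \<Rightarrow> bool" where
  "algebraic_set X \<longleftrightarrow> (\<exists>I. X = zero_locus I)"

definition irreducible_set :: "(complex ^ 'v::finite) set \<Rightarrow> bool" where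
  "irreducible_set X \<longleftrightarrow> algebraic_set X \<and> X \<noteq> {} \<and>
     (\<forall>Y Z. algebraic_set Y \<and> algebraic_set Z \<and> X = Y \<union> Z \<longrightarrow> X = Y \<or> X = Z)"

text \<open>Krull dimension in the Zariski topology: the supremum of the lengths \<open>n\<close> of strictly
  increasing chains \<open>Z 0, \<dots>, Z n\<close> of irreducible closed subsets. With values in \<open>ereal\<close>,
  the empty set has dimension \<open>-\<infinity>\<close>, and the subtraction in the codimension is not
  truncated.\<close>

definition alg_dim :: "(complex ^ 'v::finite) set \<Rightarrow> ereal" where
  "alg_dim X = Sup {ereal (real n) | n. \<exists>Z :: nat \<Rightarrow> (complex ^ 'v) set.
     (\<forall>i\<le>n. irreducible_set (Z i) \<and> Z i \<subseteq> X) \<and> (\<forall>i<n. Z i \<subset> Z (Suc i))}"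

definition codim :: "'v::finite cpoly set \<Rightarrow> ereal" where
  "codim I = ereal (real CARD('v)) - alg_dim (zero_locus I)"

section \<open>The ideal of a graph\<close>

text \<open>The variables \<open>x\<^sub>i\<close> and \<open>y\<^sub>i\<close> are indexed by \<open>Inl i\<close> and \<open>Inr i\<close>.\<close>

definition graph_poly :: "('a::finite \<Rightarrow> 'a \<Rightarrow> bool) \<Rightarrow> 'a \<Rightarrow> ('a + 'a) cpoly" where
  "graph_poly E i = (\<Sum>j\<in>nbrs E i. var (Inl j) * var (Inr i) - var (Inl i) * var (Inr j))"

definition graph_ideal :: "('a::finite \<Rightarrow> 'a \<Rightarrow> bool) \<Rightarrow> ('a + 'a) cpoly set" where
  "graph_ideal E = ideal_gen (range (graph_poly E))"

end

theory Submission
  imports Defs "HOL-Computational_Algebra.Polynomial"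
begin

text \<open>
  Think of a point as assigning to each vertex \<open>i\<close> the vector \<open>w\<^sub>i = (x\<^sub>i, y\<^sub>i)\<close>. The polynomial
  \<open>f\<^sub>i\<close> vanishes there iff \<open>w\<^sub>i\<close> is parallel to the sum of the vectors at the neighbours of \<open>i\<close>.
  Let \<open>S\<close> be the \<open>k\<close>-let and \<open>N\<close> the common neighbourhood of its vertices; \<open>N\<close> is nonempty and,
  the graph having no loops, disjoint from \<open>S\<close>. Fix a direction \<open>(1, b)\<close>. Then all \<open>f\<^sub>i\<close> vanish
  as soon as the vectors outside \<open>S\<close> have direction \<open>(1, b)\<close>, those over \<open>N\<close> add up to zero, and
  the sum of the vectors over \<open>S\<close> has direction \<open>(1, b)\<close>, the individual vectors over \<open>S\<close> being
  otherwise arbitrary: a vertex of \<open>S\<close> sees the sum zero, and a vertex outside \<open>S\<close> is adjacent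
  either to all of \<open>S\<close> or to none of it, hence sees a sum of direction \<open>(1, b)\<close>
  (\<open>let_family_subset_zero_locus\<close>).

  For fixed \<open>b\<close> these conditions are \<open>(V - k) + 1 + 1\<close> linear equations on a space of dimension
  \<open>2 V\<close>, so the solutions form a linear space of dimension at least \<open>V + k - 2\<close>
  (\<open>dim_let_family_0\<close>). Letting \<open>b\<close> vary adds one to the dimension, which gives
  \<open>V + k - 1 = 2 V - (V - k + 1)\<close>.

  With Krull dimension as the length of chains, the last step needs no dimension theory. A full
  flag in the linear space for \<open>b = 0\<close> is a chain of irreducible closed sets, and the Zariski
  closure of the union over all \<open>b\<close> can be put on top of it
  (\<open>alg_dim_gt_linear_subspace\<close>). Both the linear spaces and this closure are irreducible for the
  same reason: any two points of the set can be joined inside it by a curve with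
  polynomial coordinates, and \<open>\<complex>[s]\<close> has no zero divisors
  (\<open>irreducible_zariski_closure\<close>).
\<close>

section \<open>Evaluation of polynomials\<close>

lemma eval_cpoly_superset:
  assumes "finite M" "Poly_Mapping.keys p \<subseteq> M"
  shows "eval_cpoly p z =
    (\<Sum>m\<in>M. Poly_Mapping.lookup p m * (\<Prod>i\<in>UNIV. (z $ i) ^ Poly_Mapping.lookup m i))"
  unfolding eval_cpoly_def
  by (rule sum.mono_neutral_left) (use assms in \<open>auto simp: in_keys_iff\<close>)

lemma eval_cpoly_0 [simp]: "eval_cpoly 0 z = 0"
  by (simp add: eval_cpoly_def)

lemma eval_cpoly_add: "eval_cpoly (p + q) z = eval_cpoly p z + eval_cpoly q z"
proof -
  let ?M = "Poly_Mapping.keys p \<union> Poly_Mapping.keys q"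
  have M: "finite ?M" "Poly_Mapping.keys p \<subseteq> ?M" "Poly_Mapping.keys q \<subseteq> ?M"
    "Poly_Mapping.keys (p + q) \<subseteq> ?M"
    using keys_add[of p q] by auto
  show ?thesis
    by (simp add: eval_cpoly_superset[OF M(1,2)] eval_cpoly_superset[OF M(1,3)]
        eval_cpoly_superset[OF M(1,4)] lookup_add distrib_right sum.distrib)
qed

lemma eval_cpoly_sum: "eval_cpoly (sum f A) z = (\<Sum>a\<in>A. eval_cpoly (f a) z)"
  by (induction A rule: infinite_finite_induct) (simp_all add: eval_cpoly_add)

lemma eval_cpoly_uminus: "eval_cpoly (- p) z = - eval_cpoly p z"
  using eval_cpoly_add[of p "- p" z] by (simp add: add_eq_0_iff)

lemma eval_cpoly_diff: "eval_cpoly (p - q) z = eval_cpoly p z - eval_cpoly q z"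
  using eval_cpoly_add[of p "- q" z] by (simp add: eval_cpoly_uminus)

lemma eval_cpoly_single:
  "eval_cpoly (Poly_Mapping.single m a) z = a * (\<Prod>i\<in>UNIV. (z $ i) ^ Poly_Mapping.lookup m i)"
  by (subst eval_cpoly_superset[of "{m}"]) auto

lemma cpoly_sum_singles:
  "p = (\<Sum>m\<in>Poly_Mapping.keys p. Poly_Mapping.single m (Poly_Mapping.lookup p m))"
  by (rule poly_mapping_eqI)
    (auto simp: lookup_sum lookup_single when_def in_keys_iff)

lemma eval_cpoly_mult: "eval_cpoly (p * q) z = eval_cpoly p z * eval_cpoly q z"
proof -
  have "p * q = (\<Sum>m\<in>Poly_Mapping.keys p. \<Sum>n\<in>Poly_Mapping.keys q.
      Poly_Mapping.single (m + n) (Poly_Mapping.lookup p m * Poly_Mapping.lookup q n))"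
    by (subst cpoly_sum_singles[of p], subst cpoly_sum_singles[of q])
      (simp add: sum_product mult_single)
  then show ?thesis
    by (simp add: eval_cpoly_sum eval_cpoly_single lookup_add power_add prod.distrib)
      (simp add: eval_cpoly_def sum_product mult_ac)
qed

lemma eval_cpoly_var: "eval_cpoly (var i) z = z $ i"
proof -
  have "(\<Prod>j\<in>UNIV. (z $ j) ^ Poly_Mapping.lookup (Poly_Mapping.single i 1) j)
      = (\<Prod>j\<in>UNIV. if j = i then z $ j else 1)"
    by (rule prod.cong) (auto simp: lookup_single when_def)
  then show ?thesis
    by (simp add: var_def eval_cpoly_single)
qed

lemma eval_cpoly_ideal_gen_eq_0:
  assumes "\<And>b. b \<in> B \<Longrightarrow> eval_cpoly b z = 0" and "p \<in> ideal_gen B"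
  shows "eval_cpoly p z = 0"
  using assms(2) unfolding ideal_gen_def
  by (induction rule: module.span_induct_alt[OF module_times, consumes 1, case_names base step])
    (simp_all add: eval_cpoly_add eval_cpoly_mult assms(1))

section \<open>Zariski closures and irreducibility\<close>

definition zariski_closure :: "(complex ^ 'v::finite) set \<Rightarrow> (complex ^ 'v) set" where
  "zariski_closure W = zero_locus {p. \<forall>z\<in>W. eval_cpoly p z = 0}"

lemma zariski_closure_superset: "W \<subseteq> zariski_closure W"
  by (auto simp: zariski_closure_def zero_locus_def)

lemma zariski_closure_minimal:
  assumes "algebraic_set X" "W \<subseteq> X"
  shows "zariski_closure W \<subseteq> X"
  using assms unfolding algebraic_set_def zariski_closure_def zero_locus_def by blast

text \<open>The curves are required to be defined on the whole affine line, so that a polynomial function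
  restricted to one of them is a polynomial in a single variable.\<close>

definition polynomially_connected :: "(complex ^ 'v::finite) set \<Rightarrow> bool" where
  "polynomially_connected W \<longleftrightarrow> (\<forall>p\<in>W. \<forall>q\<in>W. \<exists>\<gamma>.
     \<gamma> 0 = p \<and> \<gamma> 1 = q \<and> range \<gamma> \<subseteq> W \<and> (\<forall>i. \<exists>r. \<forall>s. \<gamma> s $ i = poly r s))"

lemma eval_cpoly_along_polynomial_curve:
  assumes "\<forall>i. \<exists>r. \<forall>s. \<gamma> s $ i = poly r s"
  shows "\<exists>r. \<forall>s. eval_cpoly f (\<gamma> s) = poly r s"
proof -
  obtain r where r: "\<And>i s. \<gamma> s $ i = poly (r i) s"
    using assms by metis
  have "eval_cpoly f (\<gamma> s) = poly (\<Sum>m\<in>Poly_Mapping.keys f.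
      [:Poly_Mapping.lookup f m:] * (\<Prod>i\<in>UNIV. r i ^ Poly_Mapping.lookup m i)) s" for s
    by (simp add: eval_cpoly_def r poly_sum poly_prod)
  then show ?thesis
    by blast
qed

text \<open>If \<open>p\<close> and \<open>q\<close> in \<open>W\<close> avoid \<open>Y\<close> and \<open>Z\<close> respectively, this is witnessed by an equation \<open>f\<close> of
  \<open>Y\<close> and an equation \<open>g\<close> of \<open>Z\<close>. Along a curve from \<open>p\<close> to \<open>q\<close> the product of \<open>f\<close> and \<open>g\<close> vanishes
  identically, although neither factor does, which is impossible in the integral domain
  \<open>\<complex>[s]\<close>.\<close>

lemma polynomially_connected_subset_Un:
  assumes W: "polynomially_connected W"
    and Y: "algebraic_set Y" and Z: "algebraic_set Z" and sub: "W \<subseteq> Y \<union> Z"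
  shows "W \<subseteq> Y \<or> W \<subseteq> Z"
proof (rule ccontr)
  assume "\<not> ?thesis"
  then obtain p q where p: "p \<in> W" "p \<notin> Y" and q: "q \<in> W" "q \<notin> Z"
    by blast
  obtain I J where I: "Y = zero_locus I" and J: "Z = zero_locus J"
    using Y Z by (auto simp: algebraic_set_def)
  obtain f where f: "f \<in> I" "eval_cpoly f p \<noteq> 0"
    using p I by (auto simp: zero_locus_def)
  obtain g where g: "g \<in> J" "eval_cpoly g q \<noteq> 0"
    using q J by (auto simp: zero_locus_def)
  obtain \<gamma> where \<gamma>: "\<gamma> 0 = p" "\<gamma> 1 = q" "range \<gamma> \<subseteq> W" "\<forall>i. \<exists>r. \<forall>s. \<gamma> s $ i = poly r s"
    using W p q unfolding polynomially_connected_def by blast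
  obtain r where r: "\<And>s. eval_cpoly f (\<gamma> s) = poly r s"
    using eval_cpoly_along_polynomial_curve[OF \<gamma>(4)] by blast
  obtain t where t: "\<And>s. eval_cpoly g (\<gamma> s) = poly t s"
    using eval_cpoly_along_polynomial_curve[OF \<gamma>(4)] by blast
  have "poly (r * t) s = 0" for s
  proof -
    have "\<gamma> s \<in> Y \<union> Z"
      using \<gamma>(3) sub by blast
    then show ?thesis
      using f(1) g(1) by (auto simp: I J zero_locus_def r[symmetric] t[symmetric])
  qed
  then have "r * t = 0"
    using poly_all_0_iff_0 by blast
  moreover have "r \<noteq> 0" "t \<noteq> 0"
    using r[of 0] t[of 1] f(2) g(2) \<gamma>(1,2) by auto
  ultimately show False
    by simp
qed

lemma irreducible_zariski_closure:
  assumes "polynomially_connected W" "W \<noteq> {}"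
  shows "irreducible_set (zariski_closure W)"
  unfolding irreducible_set_def
proof (intro conjI allI impI)
  show "algebraic_set (zariski_closure W)"
    by (auto simp: zariski_closure_def algebraic_set_def)
  show "zariski_closure W \<noteq> {}"
    using assms(2) zariski_closure_superset[of W] by blast
next
  fix Y Z
  assume YZ: "algebraic_set Y \<and> algebraic_set Z \<and> zariski_closure W = Y \<union> Z"
  then have "W \<subseteq> Y \<or> W \<subseteq> Z"
    using assms(1) zariski_closure_superset[of W] by (intro polynomially_connected_subset_Un) auto
  then show "zariski_closure W = Y \<or> zariski_closure W = Z"
    using YZ zariski_closure_minimal by blast
qed

section \<open>Linear subspaces\<close>

text \<open>A vector \<open>x\<close> outside \<open>U\<close> is separated from \<open>U\<close> by a linear form. It is obtained as a coordinate
  of an endomorphism that kills \<open>U\<close> and fixes \<open>x\<close>.\<close>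

lemma algebraic_set_linear_subspace:
  fixes U :: "(complex ^ 'v::finite) set"
  assumes U: "vec.subspace U"
  shows "algebraic_set U"
proof -
  let ?I = "{p. \<forall>z\<in>U. eval_cpoly p z = 0}"
  have "x \<in> U" if x: "x \<in> zero_locus ?I" for x
  proof (rule ccontr)
    assume "x \<notin> U"
    obtain B where B: "B \<subseteq> U" "vec.independent B" "vec.span B = U"
      using vec.basis_exists[of U] vec.span_subspace[OF _ _ U] by metis
    have "vec.independent (insert x B)" "x \<notin> B"
      using B \<open>x \<notin> U\<close> by (auto simp: vec.independent_insert)
    then obtain g where g: "Vector_Spaces.linear (*s) (*s) g"
      "\<And>b. b \<in> insert x B \<Longrightarrow> g b = (if b = x then x else 0 :: complex ^ 'v)"
      using vec.linear_independent_extend[of "insert x B" "\<lambda>b. if b = x then x else 0"] by metis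
    interpret g: Vector_Spaces.linear "(*s)" "(*s)" g
      by (rule g(1))
    have gU: "g z = 0" if "z \<in> U" for z
      using that unfolding B(3)[symmetric]
      by (rule g.eq_0_on_span[rotated]) (use g(2) \<open>x \<notin> B\<close> in auto)
    have "x \<noteq> 0"
      using \<open>x \<notin> U\<close> U vec.subspace_0 by blast
    then obtain i where i: "g x $ i \<noteq> 0"
      using g(2)[of x] by (auto simp: vec_eq_iff)
    let ?p = "\<Sum>j\<in>UNIV. var j * Poly_Mapping.single 0 (g (axis j 1) $ i)"
    have "eval_cpoly ?p z = g z $ i" for z
      by (simp add: eval_cpoly_sum eval_cpoly_mult eval_cpoly_var eval_cpoly_single
          linear_componentwise[OF g(1), of z i])
    then have "?p \<in> ?I" "eval_cpoly ?p x \<noteq> 0"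
      using gU i by simp_all
    then show False
      using x unfolding zero_locus_def by blast
  qed
  moreover have "U \<subseteq> zero_locus ?I"
    unfolding zero_locus_def by blast
  ultimately have "U = zero_locus ?I"
    by blast
  then show ?thesis
    by (auto simp: algebraic_set_def)
qed

lemma irreducible_linear_subspace:
  fixes U :: "(complex ^ 'v::finite) set"
  assumes U: "vec.subspace U"
  shows "irreducible_set U"
proof -
  have "polynomially_connected U"
    unfolding polynomially_connected_def
  proof (intro ballI)
    fix p q
    assume pq: "p \<in> U" "q \<in> U"
    define \<gamma> where "\<gamma> s = p + s *s (q - p)" for s
    have "range \<gamma> \<subseteq> U"
      using pq U by (auto simp: \<gamma>_def intro!: vec.subspace_add vec.subspace_scale vec.subspace_diff)
    moreover have "\<gamma> s $ i = poly [:p $ i, q $ i - p $ i:] s" for s i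
      by (simp add: \<gamma>_def algebra_simps)
    moreover have "\<gamma> 0 = p" "\<gamma> 1 = q"
      by (simp_all add: \<gamma>_def)
    ultimately show "\<exists>\<gamma>. \<gamma> 0 = p \<and> \<gamma> 1 = q \<and> range \<gamma> \<subseteq> U \<and>
        (\<forall>i. \<exists>r. \<forall>s. \<gamma> s $ i = poly r s)"
      by blast
  qed
  moreover have "U \<noteq> {}"
    using vec.subspace_0[OF U] by blast
  moreover have "zariski_closure U = U"
    using zariski_closure_minimal[OF algebraic_set_linear_subspace[OF U]]
      zariski_closure_superset[of U] by blast
  ultimately show ?thesis
    using irreducible_zariski_closure by metis
qed

text \<open>A full flag of \<open>L\<close> consists of \<open>dim L + 1\<close> irreducible closed sets, and \<open>T\<close> extends this chain by
  one more step.\<close>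

lemma alg_dim_gt_linear_subspace:
  fixes L T X :: "(complex ^ 'v::finite) set"
  assumes L: "vec.subspace L" and T: "irreducible_set T" "L \<subset> T" "T \<subseteq> X"
  shows "ereal (real (Suc (vec.dim L))) \<le> alg_dim X"
proof -
  obtain B where B: "B \<subseteq> L" "vec.independent B" "L \<subseteq> vec.span B" "card B = vec.dim L"
    using vec.basis_exists by blast
  obtain xs where xs: "distinct xs" "set xs = B"
    using finite_distinct_list[OF vec.finiteI_independent[OF B(2)]] by blast
  have len: "length xs = vec.dim L"
    using xs B(4) distinct_card by metis
  have spanL: "vec.span B = L"
    using B L vec.span_subspace by blast
  define F where "F i = vec.span (set (take i xs))" for i
  define Z where "Z i = (if i \<le> vec.dim L then F i else T)" for i
  have FL: "F i \<subseteq> L" for i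
    unfolding F_def spanL[symmetric] by (rule vec.span_mono) (use xs in \<open>auto dest: in_set_takeD\<close>)
  have strict: "F i \<subset> F (Suc i)" if "i < vec.dim L" for i
  proof -
    have i: "i < length xs"
      using that len by simp
    have "xs ! i \<in> F (Suc i)"
      using i by (auto simp: F_def take_Suc_conv_app_nth intro: vec.span_base)
    moreover have "xs ! i \<notin> F i"
    proof -
      have "set (take i xs) \<subseteq> B - {xs ! i}"
        using xs i distinct_take[OF xs(1), of "Suc i"]
        by (auto simp: take_Suc_conv_app_nth dest: in_set_takeD)
      then have "F i \<subseteq> vec.span (B - {xs ! i})"
        unfolding F_def by (rule vec.span_mono)
      then show ?thesis
        using B(2) xs i nth_mem vec.dependent_def by blast
    qed
    moreover have "F i \<subseteq> F (Suc i)"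
      unfolding F_def by (intro vec.span_mono set_take_subset_set_take) simp
    ultimately show ?thesis
      by blast
  qed
  have "\<forall>i\<le>Suc (vec.dim L). irreducible_set (Z i) \<and> Z i \<subseteq> X"
    using FL T by (auto simp: Z_def F_def intro!: irreducible_linear_subspace)
  moreover have "Z i \<subset> Z (Suc i)" if "i < Suc (vec.dim L)" for i
  proof (cases "i < vec.dim L")
    case True
    then show ?thesis
      using strict by (simp add: Z_def)
  next
    case False
    then show ?thesis
      using that FL[of i] T(2) by (simp add: Z_def subset_psubset_trans)
  qed
  ultimately show ?thesis
    unfolding alg_dim_def by (intro Sup_upper) blast
qed

section \<open>A large family of zeros attached to a let\<close>

text \<open>The parameter \<open>b\<close> is the slope of the direction \<open>(1, b)\<close> common to the vectors
  outside \<open>S\<close> and to the sum of the vectors over \<open>S\<close>.\<close>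

definition let_family :: "'a::finite set \<Rightarrow> 'a set \<Rightarrow> complex \<Rightarrow> (complex ^ ('a + 'a)) set" where
  "let_family S N b = {z. (\<forall>i. i \<notin> S \<longrightarrow> z $ Inr i = b * z $ Inl i) \<and>
     (\<Sum>j\<in>N. z $ Inl j) = 0 \<and> (\<Sum>v\<in>S. z $ Inr v) = b * (\<Sum>v\<in>S. z $ Inl v)}"

lemma eval_graph_poly:
  "eval_cpoly (graph_poly E i) z =
    (\<Sum>j\<in>nbrs E i. z $ Inl j * z $ Inr i - z $ Inl i * z $ Inr j)"
  by (simp add: graph_poly_def eval_cpoly_sum eval_cpoly_diff eval_cpoly_mult eval_cpoly_var)

text \<open>At a vertex of \<open>S\<close> the vectors of the neighbours add up to zero. At a vertex \<open>i\<close> outside \<open>S\<close>,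
  where \<open>y\<^sub>i = b x\<^sub>i\<close>, the value of \<open>f\<^sub>i\<close> is \<open>x\<^sub>i\<close> times the sum of \<open>b x\<^sub>j - y\<^sub>j\<close> over the neighbours
  \<open>j\<close>; only neighbours in \<open>S\<close> contribute, and together they contribute zero.\<close>

lemma let_family_subset_zero_locus:
  assumes E: "symp E" and N: "\<And>v. v \<in> S \<Longrightarrow> nbrs E v = N" and disj: "N \<inter> S = {}"
  shows "let_family S N b \<subseteq> zero_locus (graph_ideal E)"
proof
  fix z
  assume z: "z \<in> let_family S N b"
  have out: "z $ Inr i = b * z $ Inl i" if "i \<notin> S" for i
    using z that by (simp add: let_family_def)
  have xN: "(\<Sum>j\<in>N. z $ Inl j) = 0" and yS: "(\<Sum>v\<in>S. z $ Inr v) = b * (\<Sum>v\<in>S. z $ Inl v)"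
    using z by (simp_all add: let_family_def)
  have "eval_cpoly (graph_poly E i) z = 0" for i
  proof (cases "i \<in> S")
    case True
    have "(\<Sum>j\<in>N. z $ Inr j) = (\<Sum>j\<in>N. b * z $ Inl j)"
      using disj by (intro sum.cong) (auto intro: out)
    also have "\<dots> = 0"
      by (simp add: xN flip: sum_distrib_left)
    finally show ?thesis
      by (simp add: eval_graph_poly N[OF True] sum_subtractf xN
          flip: sum_distrib_left sum_distrib_right)
  next
    case False
    \<comment> \<open>The vertices of \<open>S\<close> are indistinguishable for \<open>i\<close>, because they have the same neighbours.\<close>
    have "nbrs E i \<inter> S = {} \<or> S \<subseteq> nbrs E i"
      using N E unfolding nbrs_def symp_def by blast
    then have S0: "(\<Sum>j\<in>nbrs E i \<inter> S. b * z $ Inl j - z $ Inr j) = 0"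
    proof
      assume "S \<subseteq> nbrs E i"
      then have "nbrs E i \<inter> S = S"
        by blast
      then show ?thesis
        by (simp add: sum_subtractf yS flip: sum_distrib_left)
    qed simp
    have "eval_cpoly (graph_poly E i) z = z $ Inl i * (\<Sum>j\<in>nbrs E i. b * z $ Inl j - z $ Inr j)"
      by (simp add: eval_graph_poly out[OF False] sum_distrib_left algebra_simps)
    also have "(\<Sum>j\<in>nbrs E i. b * z $ Inl j - z $ Inr j) =
        (\<Sum>j\<in>nbrs E i \<inter> S. b * z $ Inl j - z $ Inr j)"
      by (rule sum.mono_neutral_right) (auto simp: out)
    finally show ?thesis
      by (simp add: S0)
  qed
  then show "z \<in> zero_locus (graph_ideal E)"
    unfolding zero_locus_def graph_ideal_def
    using eval_cpoly_ideal_gen_eq_0[of "range (graph_poly E)" z] by auto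
qed

text \<open>The conditions on the \<open>x\<close>-coordinates are linear and independent of \<open>b\<close>, and for given \<open>b\<close> and
  \<open>x\<close> those on the \<open>y\<close>-coordinates can be solved for the \<open>y\<^sub>i\<close> with \<open>i\<close> outside \<open>S\<close> and for one
  \<open>y\<close>-coordinate over \<open>S\<close>. Hence one can interpolate linearly in \<open>b\<close> and in all remaining
  coordinates; the coordinates solved for become polynomials of degree at most two.\<close>

lemma polynomially_connected_let_family:
  assumes v0: "v0 \<in> S"
  shows "polynomially_connected (\<Union>b. let_family S N b)"
  unfolding polynomially_connected_def
proof (intro ballI)
  fix p q
  assume "p \<in> (\<Union>b. let_family S N b)" "q \<in> (\<Union>b. let_family S N b)"
  then obtain a c where p: "p \<in> let_family S N a" and q: "q \<in> let_family S N c"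
    by blast
  define line where "line s i = p $ i + s * (q $ i - p $ i)" for s i
  define b where "b s = a + s * (c - a)" for s
  \<comment> \<open>The correction to \<open>y\<close> at \<open>v0\<close> that restores the condition on the sum over \<open>S\<close>; it is zero
    at both ends of the curve, where the condition holds already.\<close>
  define corr where "corr s = b s * (\<Sum>v\<in>S. line s (Inl v)) - (\<Sum>v\<in>S. line s (Inr v))" for s
  define y where "y s i = (if i \<notin> S then b s * line s (Inl i)
      else line s (Inr i) + (if i = v0 then corr s else 0))" for s i
  define \<gamma> :: "complex \<Rightarrow> complex ^ ('a + 'a)" where
    "\<gamma> s = (\<chi> i. case i of Inl j \<Rightarrow> line s (Inl j) | Inr j \<Rightarrow> y s j)" for s
  have "\<gamma> 0 = p" "\<gamma> 1 = q"
    using p q by (auto simp: vec_eq_iff \<gamma>_def y_def line_def b_def corr_def let_family_def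
        split: sum.splits)
  moreover have "\<gamma> s \<in> let_family S N (b s)" for s
  proof -
    have "(\<Sum>j\<in>N. line s (Inl j)) = 0"
      using p q by (simp add: line_def let_family_def sum.distrib sum_subtractf
          flip: sum_distrib_left)
    moreover have "(\<Sum>v\<in>S. y s v) = (\<Sum>v\<in>S. line s (Inr v) + (if v = v0 then corr s else 0))"
      by (intro sum.cong) (simp_all add: y_def)
    then have "(\<Sum>v\<in>S. y s v) = b s * (\<Sum>v\<in>S. line s (Inl v))"
      using v0 by (simp add: sum.distrib corr_def)
    ultimately show ?thesis
      by (simp add: let_family_def \<gamma>_def) (simp add: y_def)
  qed
  moreover have "\<exists>r. \<forall>s. \<gamma> s $ i = poly r s" for i
  proof -
    define pl where "pl j = [:p $ j, q $ j - p $ j:]" for j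
    define pb where "pb = [:a, c - a:]"
    have pl: "line s j = poly (pl j) s" and pb: "b s = poly pb s" for s j
      by (simp_all add: line_def b_def pl_def pb_def)
    have corr: "corr s = poly (pb * (\<Sum>v\<in>S. pl (Inl v)) - (\<Sum>v\<in>S. pl (Inr v))) s" for s
      by (simp add: corr_def pl pb poly_sum)
    show ?thesis
    proof (cases i)
      case (Inl j)
      then show ?thesis
        by (auto simp: \<gamma>_def pl)
    next
      case (Inr j)
      have "\<gamma> s $ i = poly (if j \<notin> S then pb * pl (Inl j) else pl (Inr j) +
          (if j = v0 then pb * (\<Sum>v\<in>S. pl (Inl v)) - (\<Sum>v\<in>S. pl (Inr v)) else 0)) s" for s
        by (simp add: Inr \<gamma>_def y_def pl pb corr)
      then show ?thesis
        by blast
    qed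
  qed
  ultimately show "\<exists>\<gamma>. \<gamma> 0 = p \<and> \<gamma> 1 = q \<and> range \<gamma> \<subseteq> (\<Union>b. let_family S N b) \<and>
      (\<forall>i. \<exists>r. \<forall>s. \<gamma> s $ i = poly r s)"
    by (intro exI[of _ \<gamma>]) blast
qed

lemma subspace_let_family_0: "vec.subspace (let_family S N 0)"
  by (auto simp: vec.subspace_def let_family_def sum.distrib simp flip: sum_distrib_left)

text \<open>The count of equations, in the form that the linear space together with as many unit vectors as
  there are equations spans everything.\<close>

lemma dim_let_family_0:
  fixes S N :: "'a::finite set"
  assumes v0: "v0 \<in> S" and n0: "n0 \<in> N"
  shows "2 * CARD('a) \<le> vec.dim (let_family S N 0) + (CARD('a) - card S) + 2"
proof -
  let ?L = "let_family S N 0"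
  let ?C = "insert (axis (Inl n0) 1) (insert (axis (Inr v0) 1)
    ((\<lambda>i. axis (Inr i) 1) ` (- S))) :: (complex ^ ('a + 'a)) set"
  obtain B where B: "B \<subseteq> ?L" "vec.independent B" "?L \<subseteq> vec.span B" "card B = vec.dim ?L"
    using vec.basis_exists by blast
  have finB: "finite B"
    by (rule vec.finiteI_independent[OF B(2)])
  have "z \<in> vec.span (B \<union> ?C)" for z
  proof -
    \<comment> \<open>Each unit vector in \<open>c\<close> repairs the failure of \<open>z\<close> to satisfy one of the equations and does
      not affect the others, so that \<open>z - c\<close> satisfies them all.\<close>
    define c where "c = (\<Sum>j\<in>N. z $ Inl j) *s axis (Inl n0) 1
      + ((\<Sum>v\<in>S. z $ Inr v) *s axis (Inr v0) 1 + (\<Sum>i\<in>- S. z $ Inr i *s axis (Inr i) 1))"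
    have c: "c \<in> vec.span (B \<union> ?C)"
      unfolding c_def
      by (intro vec.span_add vec.span_sum vec.span_scale vec.span_base) auto
    have cl: "c $ Inl j = (if j = n0 then \<Sum>j\<in>N. z $ Inl j else 0)" for j
      by (simp add: c_def axis_def)
    have cr: "c $ Inr i = (if i \<in> S then if i = v0 then \<Sum>v\<in>S. z $ Inr v else 0 else z $ Inr i)" for i
      using v0 by (auto simp: c_def axis_def if_distrib[of "\<lambda>x. _ * x"] cong: if_cong)
    have "z - c \<in> ?L"
      using v0 n0 by (simp add: let_family_def sum_subtractf cl cr)
    then have "z - c \<in> vec.span (B \<union> ?C)"
      using B(3) vec.span_mono[of B "B \<union> ?C"] by blast
    then show ?thesis
      using c vec.span_add by fastforce
  qed
  then have "vec.dim (UNIV :: (complex ^ ('a + 'a)) set) \<le> card (B \<union> ?C)"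
    using finB by (intro vec.dim_le_card) auto
  also have "\<dots> \<le> card B + card ?C"
    by (rule card_Un_le)
  also have "card ?C \<le> (CARD('a) - card S) + 2"
  proof -
    have "card ((\<lambda>i. axis (Inr i) 1 :: complex ^ ('a + 'a)) ` (- S)) \<le> CARD('a) - card S"
      using card_image_le[of "- S" "\<lambda>i. axis (Inr i) 1 :: complex ^ ('a + 'a)"]
      by (simp add: Compl_eq_Diff_UNIV card_Diff_subset)
    then show ?thesis
      by (intro order_trans[OF card_insert_le_m1] card_insert_le_m1) auto
  qed
  finally show ?thesis
    by (simp add: B(4) card_cart_basis)
qed

lemma let_family_0_psubset:
  fixes S N :: "'a::finite set"
  assumes v0: "v0 \<in> S" and disj: "N \<inter> S = {}"
  shows "let_family S N 0 \<subset> (\<Union>b. let_family S N b)"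
proof -
  \<comment> \<open>All vectors are zero except the one at \<open>v0\<close>, which has slope \<open>1\<close>.\<close>
  define z :: "complex ^ ('a + 'a)" where
    "z = axis (Inl v0) 1 + axis (Inr v0) 1"
  have "z \<in> let_family S N 1" "z \<notin> let_family S N 0"
    using v0 disj by (auto simp: let_family_def z_def axis_def sum.neutral)
  then show ?thesis
    by blast
qed

theorem theorem2p8:
  fixes E :: "'a::finite \<Rightarrow> 'a \<Rightarrow> bool" and k :: nat
  assumes "sct_graph E"
    and "k \<ge> 3"
    and "\<exists>S. is_let E k S"
  shows "codim (graph_ideal E) \<le> ereal (real CARD('a) - real k + 1)"
proof -
  obtain S where S: "card S = k" "\<And>v w. v \<in> S \<Longrightarrow> w \<in> S \<Longrightarrow> nbrs E v = nbrs E w"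
    using assms(3) by (auto simp: is_let_def)
  obtain v0 where v0: "v0 \<in> S"
    using S(1) assms(2) by fastforce
  define N where "N = nbrs E v0"
  have E: "symp E" "irreflp E" "card N \<ge> 2"
    using assms(1) by (auto simp: sct_graph_def N_def)
  have N: "nbrs E v = N" if "v \<in> S" for v
    using S(2)[OF that v0] by (simp only: N_def)
  obtain n0 where n0: "n0 \<in> N"
    using E(3) by fastforce
  have disj: "N \<inter> S = {}"
    using N E(2) by (auto simp: nbrs_def irreflp_def)
  let ?L = "let_family S N 0" and ?W = "\<Union>b. let_family S N b"
  let ?X = "zero_locus (graph_ideal E)"
  have "?W \<subseteq> ?X"
    using let_family_subset_zero_locus[OF E(1) N disj] by blast
  then have "zariski_closure ?W \<subseteq> ?X"
    by (intro zariski_closure_minimal) (auto simp: algebraic_set_def)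
  moreover have "?L \<subset> zariski_closure ?W"
    using let_family_0_psubset[OF v0 disj] zariski_closure_superset[of ?W] by blast
  moreover have "irreducible_set (zariski_closure ?W)"
    using polynomially_connected_let_family[OF v0] let_family_0_psubset[OF v0 disj]
    by (intro irreducible_zariski_closure) auto
  ultimately have "ereal (real (Suc (vec.dim ?L))) \<le> alg_dim ?X"
    by (intro alg_dim_gt_linear_subspace[OF subspace_let_family_0])
  moreover have "k \<le> CARD('a)"
    using S(1) card_mono[of UNIV S] by simp
  then have "real CARD('a) + real k - 1 \<le> real (Suc (vec.dim ?L))"
    using dim_let_family_0[OF v0 n0] S(1) by linarith
  ultimately have "ereal (real CARD('a) + real k - 1) \<le> alg_dim ?X"
    by (meson ereal_less_eq(3) order_trans)
  then have "codim (graph_ideal E) \<le>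
      ereal (real CARD('a + 'a)) - ereal (real CARD('a) + real k - 1)"
    unfolding codim_def by (intro ereal_minus_mono) simp_all
  then show ?thesis
    by (simp add: algebra_simps)
qed

end
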